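(* Let $d\ge1$, let $\Delta$ be a $(d-1)$-dimensional simplicial complex and let $\Delta_{\mathcal{F}}$ be its barycentric subdivision. For a $(d-1)$-dimensional simplicial complex $\Gamma$ consider the conditions (a) $h_0^\Gamma,\ldots,h_d^\Gamma>0$ and $$\frac{h_0^\Gamma}{h_d^\Gamma}\le \frac{h_1^\Gamma}{h_{d-1}^\Gamma}\le\cdots\le\frac{h_{d-1}^\Gamma}{h_1^\Gamma}\le\frac{h_d^\Gamma}{h_0^\Gamma};$$ (b) $h_1^\Gamma,\ldots,h_{d-1}^\Gamma>0$, $h_d^\Gamma=0$ and $$\frac{h_1^\Gamma}{h_{d-1}^\Gamma}\ge\cdots\ge\frac{h_{d-2}^\Gamma}{h_2^\Gamma}\ge\frac{h_{d-1}^\Gamma}{h_1^\Gamma}.$$ If $\Delta$ satisfies (a), then $\Delta_{\mathcal{F}}$ satisfies (a); and if $\Delta$ satisfies (b), then $\Delta_{\mathcal{F}}$ satisfies (b).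
   Context: For a finite $(d-1)$-dimensional simplicial complex $\Delta$, let $f_i^\Delta$ be the number of faces of dimension $i$ (i.e. of cardinality $i+1$), $-1\le i\le d-1$, and define the $h$-vector $h^\Delta=(h_0^\Delta,\ldots,h_d^\Delta)$ by $\sum_{i=0}^d f_{i-1}^\Delta (x-1)^{d-i}=\sum_{i=0}^d h_i^\Delta x^{d-i}$. The barycentric subdivision $\Delta_{\mathcal{F}}$ of $\Delta$ is the simplicial complex whose vertices are the nonempty faces of $\Delta$ and whose faces are the chains (sets of nonempty faces totally ordered by inclusion). *)

theory Defs
  imports Complex_Main "HOL-Computational_Algebra.Polynomial"
begin

section \<open>Finite abstract simplicial complexes\<close>

text \<open>A complex is given by its set of faces. It is nonempty, so the empty set is always a face,
  of dimension \<open>-1\<close>.\<close>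

definition simplicial_complex :: "'a set set \<Rightarrow> bool" where
  "simplicial_complex \<Delta> \<longleftrightarrow>
     finite \<Delta> \<and> \<Delta> \<noteq> {} \<and> (\<forall>F\<in>\<Delta>. finite F) \<and> (\<forall>F\<in>\<Delta>. \<forall>G. G \<subseteq> F \<longrightarrow> G \<in> \<Delta>)"

definition face_dim :: "'a set \<Rightarrow> int" where
  "face_dim F = int (card F) - 1"

definition complex_dim :: "'a set set \<Rightarrow> int" where
  "complex_dim \<Delta> = Max (face_dim ` \<Delta>)"

definition f_vec :: "'a set set \<Rightarrow> int \<Rightarrow> nat" where
  "f_vec \<Delta> i = card {F \<in> \<Delta>. face_dim F = i}"

text \<open>With \<open>d = complex_dim \<Delta> + 1\<close>, the polynomial
  \<open>\<Sum>i=0..d. f\<^bsub>i-1\<^esub> (x - 1) ^ (d - i)\<close>; here \<open>[:-1, 1:]\<close> is \<open>x - 1\<close>.\<close>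

definition h_poly :: "'a set set \<Rightarrow> int poly" where
  "h_poly \<Delta> = (let d = nat (complex_dim \<Delta> + 1) in
     \<Sum>i\<le>d. smult (int (f_vec \<Delta> (int i - 1))) ([:-1, 1:] ^ (d - i)))"

text \<open>The number \<open>h\<^sub>i\<close> is the coefficient of \<open>x ^ (d - i)\<close>, for \<open>i \<le> d\<close>
  (see \<open>h_vec_unique\<close> below); the value for \<open>i > d\<close> is a convention.\<close>

definition h_vec :: "'a set set \<Rightarrow> nat \<Rightarrow> int" where
  "h_vec \<Delta> i = (let d = nat (complex_dim \<Delta> + 1) in
     if i \<le> d then coeff (h_poly \<Delta>) (d - i) else 0)"

definition barycentric_subdivision :: "'a set set \<Rightarrow> 'a set set set" where
  "barycentric_subdivision \<Delta> = {C. subset.chain (\<Delta> - {{}}) C}"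

text \<open>The two conditions on a complex \<open>\<Gamma>\<close> of dimension \<open>d - 1\<close>.
  The chains of inequalities are stated for consecutive members;
  all denominators are positive by the preceding conjuncts.\<close>

definition condition_a :: "nat \<Rightarrow> 'a set set \<Rightarrow> bool" where
  "condition_a d \<Gamma> \<longleftrightarrow>
     (\<forall>i\<le>d. h_vec \<Gamma> i > 0) \<and>
     (\<forall>i<d. real_of_int (h_vec \<Gamma> i) / real_of_int (h_vec \<Gamma> (d - i))
            \<le> real_of_int (h_vec \<Gamma> (i + 1)) / real_of_int (h_vec \<Gamma> (d - (i + 1))))"

definition condition_b :: "nat \<Rightarrow> 'a set set \<Rightarrow> bool" where
  "condition_b d \<Gamma> \<longleftrightarrow>
     (\<forall>i. 1 \<le> i \<and> i < d \<longrightarrow> h_vec \<Gamma> i > 0) \<and> h_vec \<Gamma> d = 0 \<and>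
     (\<forall>i. 1 \<le> i \<and> i + 1 < d \<longrightarrow>
        real_of_int (h_vec \<Gamma> i) / real_of_int (h_vec \<Gamma> (d - i))
        \<ge> real_of_int (h_vec \<Gamma> (i + 1)) / real_of_int (h_vec \<Gamma> (d - (i + 1))))"


section \<open>Adequacy of the definitions\<close>

lemma h_vec_identity:
  fixes \<Delta> :: "'a set set"
  defines "d \<equiv> nat (complex_dim \<Delta> + 1)"
  shows "(\<Sum>i\<le>d. smult (int (f_vec \<Delta> (int i - 1))) ([:-1, 1:] ^ (d - i)))
       = (\<Sum>i\<le>d. monom (h_vec \<Delta> i) (d - i))"
proof -
  have "degree (h_poly \<Delta>) \<le> d"
    unfolding h_poly_def Let_def d_def[symmetric]
  proof (intro degree_sum_le)
    fix i assume "i \<in> {..d}"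
    have "degree ([:-1, 1::int:] ^ (d - i)) \<le> d - i"
      using degree_power_le[of "[:-1, 1::int:]" "d - i"] by simp
    thus "degree (smult (int (f_vec \<Delta> (int i - 1))) ([:-1, 1:] ^ (d - i))) \<le> d"
      using degree_smult_le[of "int (f_vec \<Delta> (int i - 1))" "[:-1, 1:] ^ (d - i)"] by linarith
  qed simp
  hence "h_poly \<Delta> = (\<Sum>j\<le>d. monom (coeff (h_poly \<Delta>) j) j)"
    by (simp add: poly_as_sum_of_monoms')
  also have "\<dots> = (\<Sum>i\<le>d. monom (h_vec \<Delta> i) (d - i))"
    by (rule sum.reindex_bij_witness[of _ "\<lambda>i. d - i" "\<lambda>i. d - i"])
       (auto simp: h_vec_def d_def[symmetric])
  finally show ?thesis by (simp add: h_poly_def d_def Let_def)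
qed

lemma h_vec_unique:
  fixes \<Delta> :: "'a set set" and h :: "nat \<Rightarrow> int"
  defines "d \<equiv> nat (complex_dim \<Delta> + 1)"
  assumes h: "(\<Sum>i\<le>d. smult (int (f_vec \<Delta> (int i - 1))) ([:-1, 1:] ^ (d - i)))
       = (\<Sum>i\<le>d. monom (h i) (d - i))" and "i \<le> d"
  shows "h i = h_vec \<Delta> i"
proof -
  have *: "coeff (\<Sum>k\<le>d. monom (g k) (d - k)) (d - i) = g i" for g :: "nat \<Rightarrow> int"
  proof -
    have "coeff (\<Sum>k\<le>d. monom (g k) (d - k)) (d - i) = (\<Sum>k\<le>d. if k = i then g k else 0)"
      unfolding coeff_sum using \<open>i \<le> d\<close> by (intro sum.cong) auto
    thus ?thesis using \<open>i \<le> d\<close> by simp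
  qed
  have "(\<Sum>i\<le>d. monom (h i) (d - i)) = (\<Sum>i\<le>d. monom (h_vec \<Delta> i) (d - i))"
    using h h_vec_identity[of \<Delta>] by (simp add: d_def)
  thus ?thesis using *[of h] *[of "h_vec \<Delta>"] by simp
qed

lemma simplicial_complex_barycentric_subdivision:
  assumes "simplicial_complex \<Delta>"
  shows "simplicial_complex (barycentric_subdivision \<Delta>)"
proof -
  have fin: "finite \<Delta>" using assms by (simp add: simplicial_complex_def)
  have sub: "barycentric_subdivision \<Delta> \<subseteq> Pow \<Delta>"
    by (auto simp: barycentric_subdivision_def subset_chain_def)
  have "{} \<in> barycentric_subdivision \<Delta>"
    by (simp add: barycentric_subdivision_def subset_chain_def)
  moreover have "G \<in> barycentric_subdivision \<Delta>"
    if "F \<in> barycentric_subdivision \<Delta>" "G \<subseteq> F" for F G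
    using that unfolding barycentric_subdivision_def subset_chain_def mem_Collect_eq by blast
  moreover have "finite (barycentric_subdivision \<Delta>)"
    using sub fin finite_subset by blast
  moreover have "finite C" if "C \<in> barycentric_subdivision \<Delta>" for C
    using that sub fin finite_subset[of C \<Delta>] by blast
  ultimately show ?thesis unfolding simplicial_complex_def by blast
qed

lemma card_chain_le:
  assumes "finite C" "\<forall>X\<in>C. \<forall>Y\<in>C. X \<subseteq> Y \<or> Y \<subseteq> X" "\<forall>X\<in>C. finite X \<and> X \<noteq> {} \<and> card X \<le> n"
  shows "card C \<le> n"
proof -
  have "inj_on card C"
  proof (rule inj_onI)
    fix X Y assume "X \<in> C" "Y \<in> C" "card X = card Y"
    moreover from this have "X \<subseteq> Y \<or> Y \<subseteq> X" "finite X" "finite Y" using assms(2,3) by auto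
    ultimately show "X = Y" using card_subset_eq[of Y X] card_subset_eq[of X Y] by auto
  qed
  moreover have "card ` C \<subseteq> {1..n}"
  proof
    fix k assume "k \<in> card ` C"
    then obtain X where X: "X \<in> C" "k = card X" by (elim imageE) (rule that)
    hence "finite X" "X \<noteq> {}" "card X \<le> n" using assms(3) by simp_all
    thus "k \<in> {1..n}" using X card_gt_0_iff[of X] by simp
  qed
  ultimately show ?thesis
    using card_inj_on_le[of card C "{1..n}"] by simp
qed

lemma chain_of_card:
  assumes "finite F"
  shows "\<exists>C. finite C \<and> card C = card F \<and> (\<forall>X\<in>C. X \<subseteq> F \<and> X \<noteq> {}) \<and>
             (\<forall>X\<in>C. \<forall>Y\<in>C. X \<subseteq> Y \<or> Y \<subseteq> X)"
  using assms
proof (induction F rule: finite_induct)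
  case empty
  show ?case by (intro exI[of _ "{}"]) auto
next
  case (insert a F)
  then obtain C where C: "finite C" "card C = card F" "\<forall>X\<in>C. X \<subseteq> F \<and> X \<noteq> {}"
    "\<forall>X\<in>C. \<forall>Y\<in>C. X \<subseteq> Y \<or> Y \<subseteq> X" by (elim exE conjE) (rule that)
  have "insert a F \<notin> C"
  proof
    assume "insert a F \<in> C"
    hence "insert a F \<subseteq> F" using bspec[OF C(3)] by blast
    thus False using insert.hyps by simp
  qed
  hence "card (insert (insert a F) C) = card (insert a F)"
    using C(1,2) insert.hyps by simp
  moreover have "\<forall>X\<in>insert (insert a F) C. X \<subseteq> insert a F \<and> X \<noteq> {}"
    using C(3) by auto
  moreover have "\<forall>X\<in>insert (insert a F) C. \<forall>Y\<in>insert (insert a F) C. X \<subseteq> Y \<or> Y \<subseteq> X"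
    using C(3,4) by auto
  ultimately show ?case using C(1) by (intro exI[of _ "insert (insert a F) C"]) simp
qed

lemma complex_dim_barycentric_subdivision:
  assumes "simplicial_complex \<Delta>"
  shows "complex_dim (barycentric_subdivision \<Delta>) = complex_dim \<Delta>"
proof -
  have fin: "finite \<Delta>" and ne: "\<Delta> \<noteq> {}"
    and ff: "F \<in> \<Delta> \<Longrightarrow> finite F"
    and dn: "F \<in> \<Delta> \<Longrightarrow> G \<subseteq> F \<Longrightarrow> G \<in> \<Delta>" for F G
    using assms unfolding simplicial_complex_def by simp_all
  have "complex_dim \<Delta> \<in> face_dim ` \<Delta>"
    unfolding complex_dim_def using fin ne by (intro Max_in) simp_all
  then obtain F where F: "F \<in> \<Delta>" "complex_dim \<Delta> = face_dim F" by (elim imageE) (rule that)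
  have le: "card X \<le> card F" if "X \<in> \<Delta>" for X
  proof -
    have "face_dim X \<le> complex_dim \<Delta>"
      unfolding complex_dim_def using that fin by (intro Max_ge) simp_all
    thus ?thesis using F(2) by (simp add: face_dim_def)
  qed
  obtain C where C: "finite C" "card C = card F" "\<forall>X\<in>C. X \<subseteq> F \<and> X \<noteq> {}"
    "\<forall>X\<in>C. \<forall>Y\<in>C. X \<subseteq> Y \<or> Y \<subseteq> X"
    using chain_of_card[OF ff[OF F(1)]] by (elim exE conjE) (rule that)
  have CB: "C \<in> barycentric_subdivision \<Delta>"
    unfolding barycentric_subdivision_def subset_chain_def mem_Collect_eq
    using C(3,4) dn[OF F(1)] by (simp add: subset_iff)
  have max: "card D \<le> card F" if "D \<in> barycentric_subdivision \<Delta>" for D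
  proof (rule card_chain_le)
    have D: "D \<subseteq> \<Delta> - {{}}" "\<forall>X\<in>D. \<forall>Y\<in>D. X \<subseteq> Y \<or> Y \<subseteq> X"
      using that by (auto simp: barycentric_subdivision_def subset_chain_def)
    show "\<forall>X\<in>D. \<forall>Y\<in>D. X \<subseteq> Y \<or> Y \<subseteq> X" by (fact D)
    show "finite D" using D fin by (meson finite_Diff finite_subset)
    show "\<forall>X\<in>D. finite X \<and> X \<noteq> {} \<and> card X \<le> card F"
    proof
      fix X assume "X \<in> D"
      hence "X \<in> \<Delta>" "X \<noteq> {}" using D(1) by blast+
      thus "finite X \<and> X \<noteq> {} \<and> card X \<le> card F" by (simp add: ff le)
    qed
  qed
  have "finite (barycentric_subdivision \<Delta>)"
    using simplicial_complex_barycentric_subdivision[OF assms]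
    by (simp add: simplicial_complex_def)
  moreover have "face_dim F \<in> face_dim ` barycentric_subdivision \<Delta>"
    using CB C(2) by (intro image_eqI[of _ _ C]) (simp_all add: face_dim_def)
  ultimately have "Max (face_dim ` barycentric_subdivision \<Delta>) = face_dim F"
  proof (intro Max_eqI)
    fix k assume "k \<in> face_dim ` barycentric_subdivision \<Delta>"
    then obtain D where D: "D \<in> barycentric_subdivision \<Delta>" "k = face_dim D"
      by (elim imageE) (rule that)
    show "k \<le> face_dim F" using max[OF D(1)] D(2) by (simp add: face_dim_def)
  qed simp_all
  thus ?thesis using F by (simp add: complex_dim_def)
qed

end

theory Submission
  imports Defs
begin

text \<open>The \<open>h\<close>-vector of the subdivision is a fixed nonnegative matrix applied to the
  \<open>h\<close>-vector of the complex. Its entries (the refined Eulerian numbers of Brenti and Welker,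
  which count permutations of \<open>d + 1\<close> letters by first letter and descents)
  obey a recurrence in \<open>d\<close> that comes from removing the top element of a chain: with rows
  \<open>P\<^sub>d\<^sub>,\<^sub>0, \<dots>, P\<^sub>d\<^sub>,\<^sub>d\<close> read as polynomials,
  \<open>P\<^sub>d\<^sub>+\<^sub>1\<^sub>,\<^sub>r = x (P\<^sub>d\<^sub>,\<^sub>r + \<dots> + P\<^sub>d\<^sub>,\<^sub>d) + (P\<^sub>d\<^sub>,\<^sub>0 + \<dots> + P\<^sub>d\<^sub>,\<^sub>r\<^sub>-\<^sub>1)\<close>
  (\<open>sd_row_Suc\<close>).

  Two properties of this matrix suffice. It is invariant under rotation by 180 degrees, and its
  minors on two adjacent powers of \<open>x\<close> have constant sign. By the Cauchy--Binet formula for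
  \<open>2 \<times> 2\<close> minors (\<open>sum_ratio_mono\<close>), a matrix with these properties
  preserves the direction in which \<open>h\<^sub>i / h\<^bsub>d-i\<^esub>\<close> is monotone: by the rotation
  symmetry, numerator and denominator of a ratio for the subdivision are the same linear form,
  evaluated at \<open>h\<close> and at its reversal.

  The sign of the minors is seen by writing the coefficients of all rows into one sequence
  \<open>w\<^sub>d\<close>, first the constant terms of \<open>P\<^sub>d\<^sub>,\<^sub>0, \<dots>, P\<^sub>d\<^sub>,\<^sub>d\<close>, next the coefficients of \<open>x\<close>, and
  so on. The sign condition says that \<open>w\<^sub>d(p) / w\<^sub>d(p + d + 1)\<close> is nondecreasing in
  \<open>p\<close>, and the recurrence says that every entry of \<open>w\<^sub>d\<^sub>+\<^sub>1\<close> is the sum of \<open>d + 1\<close> consecutive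
  entries of \<open>w\<^sub>d\<close>. Monotone ratios survive such window sums, once more by
  Cauchy--Binet, because the indicator functions of two windows of equal length have a monotone ratio.
  So the property propagates from \<open>d = 0\<close>, where it is trivial.\<close>

section \<open>Monotone ratios\<close>

text \<open>If \<open>f / g\<close> and \<open>u / v\<close> are nondecreasing, then
  \<open>\<langle>f, v\<rangle> / \<langle>g, v\<rangle> \<le> \<langle>f, u\<rangle> / \<langle>g, u\<rangle>\<close>; everything is cross-multiplied, so that zeros
  are harmless. By the Cauchy--Binet formula, twice the difference of the two sides is the sum, over
  all pairs of indices, of products of a minor of \<open>(f, g)\<close> and a minor of \<open>(u, v)\<close>, and these have
  the same sign.\<close>

lemma sum_ratio_mono:
  fixes f g u v :: "'i::linorder \<Rightarrow> int"
  assumes fg: "\<And>r s. r \<in> S \<Longrightarrow> s \<in> S \<Longrightarrow> r \<le> s \<Longrightarrow> f r * g s \<le> f s * g r"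
    and uv: "\<And>r s. r \<in> S \<Longrightarrow> s \<in> S \<Longrightarrow> r \<le> s \<Longrightarrow> u r * v s \<le> u s * v r"
  shows "(\<Sum>r\<in>S. f r * v r) * (\<Sum>r\<in>S. g r * u r) \<le> (\<Sum>r\<in>S. f r * u r) * (\<Sum>r\<in>S. g r * v r)"
proof -
  define m where "m r s = f r * g s * (u r * v s)" for r s
  define m' where "m' r s = f r * g s * (v r * u s)" for r s
  have "0 \<le> (\<Sum>r\<in>S. \<Sum>s\<in>S. (f r * g s - f s * g r) * (u r * v s - u s * v r))"
  proof (intro sum_nonneg)
    fix r s assume "r \<in> S" "s \<in> S"
    then show "0 \<le> (f r * g s - f s * g r) * (u r * v s - u s * v r)"
      using fg[of r s] uv[of r s] fg[of s r] uv[of s r]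
      by (cases "r \<le> s") (auto intro!: mult_nonneg_nonneg mult_nonpos_nonpos)
  qed
  also have "\<dots> = (\<Sum>r\<in>S. \<Sum>s\<in>S. (m r s - m' r s) + (m s r - m' s r))"
    by (intro sum.cong refl) (simp add: m_def m'_def algebra_simps)
  also have "\<dots> = 2 * ((\<Sum>r\<in>S. \<Sum>s\<in>S. m r s) - (\<Sum>r\<in>S. \<Sum>s\<in>S. m' r s))"
    unfolding sum.distrib sum_subtractf sum.swap[of "\<lambda>r s. m s r" S S] sum.swap[of "\<lambda>r s. m' s r" S S]
    by simp
  also have "(\<Sum>r\<in>S. \<Sum>s\<in>S. m r s) = (\<Sum>r\<in>S. f r * u r) * (\<Sum>r\<in>S. g r * v r)"
    by (simp add: m_def sum_product algebra_simps)
  also have "(\<Sum>r\<in>S. \<Sum>s\<in>S. m' r s) = (\<Sum>r\<in>S. f r * v r) * (\<Sum>r\<in>S. g r * u r)"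
    by (simp add: m'_def sum_product algebra_simps)
  finally show ?thesis by simp
qed

lemma window_sum_ratio_mono:
  fixes f g :: "int \<Rightarrow> int"
  assumes fg: "\<And>x y. x \<le> y \<Longrightarrow> f x * g y \<le> f y * g x" and "a \<le> b" "0 \<le> n"
  shows "(\<Sum>q\<in>{a-n..<a}. f q) * (\<Sum>q\<in>{b-n..<b}. g q)
       \<le> (\<Sum>q\<in>{b-n..<b}. f q) * (\<Sum>q\<in>{a-n..<a}. g q)"
proof -
  have window: "(\<Sum>q\<in>{a-n..<b}. h q * of_bool (q \<in> W)) = (\<Sum>q\<in>W. h q)"
    if "W \<subseteq> {a-n..<b}" for h :: "int \<Rightarrow> int" and W
  proof -
    have "{a-n..<b} \<inter> {q. q \<in> W} = W" using that by blast
    then show ?thesis by (simp add: of_bool_def sum.If_cases if_distrib cong: if_cong)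
  qed
  have "(\<Sum>q\<in>{a-n..<b}. f q * of_bool (q \<in> {a-n..<a})) * (\<Sum>q\<in>{a-n..<b}. g q * of_bool (q \<in> {b-n..<b}))
      \<le> (\<Sum>q\<in>{a-n..<b}. f q * of_bool (q \<in> {b-n..<b})) * (\<Sum>q\<in>{a-n..<b}. g q * of_bool (q \<in> {a-n..<a}))"
    using \<open>a \<le> b\<close> by (intro sum_ratio_mono fg) auto
  moreover have "{a-n..<a} \<subseteq> {a-n..<b}" "{b-n..<b} \<subseteq> {a-n..<b}" using assms by auto
  ultimately show ?thesis by (simp only: window)
qed

section \<open>The unrolled transformation matrix\<close>

text \<open>The entry at position \<open>e (d + 1) + r\<close>, for \<open>0 \<le> r \<le> d\<close>, is the coefficient of \<open>x\<^sup>e\<close> in row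
  \<open>r\<close> of the matrix for dimension \<open>d - 1\<close> (see \<open>coeff_sd_row\<close>). On level \<open>d + 1\<close> that entry
  has position \<open>p = e (d + 2) + r\<close>, and \<open>p - p div (d + 2) = e (d + 1) + r\<close> translates it to
  level \<open>d\<close>. Integer positions make the sequence vanish at both ends without boundary cases.\<close>

primrec unrolled :: "nat \<Rightarrow> int \<Rightarrow> int" where
  "unrolled 0 p = of_bool (p = 0)"
| "unrolled (Suc d) p =
    (let a = p - p div (int d + 2) in \<Sum>q\<in>{a - (int d + 1)..<a}. unrolled d q)"

declare unrolled.simps(2) [simp del]

lemma unrolled_Suc:
  assumes "0 \<le> r" "r \<le> int d + 1"
  shows "unrolled (Suc d) (e * (int d + 2) + r) =
    (\<Sum>q\<in>{(e - 1) * (int d + 1) + r..<e * (int d + 1) + r}. unrolled d q)"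
proof -
  have "(e * (int d + 2) + r) div (int d + 2) = e"
    using assms by (simp add: div_pos_pos_trivial)
  then show ?thesis by (simp add: unrolled.simps(2) Let_def algebra_simps)
qed

lemma shift_position_mono:
  assumes "x \<le> (y::int)" "1 \<le> k"
  shows "x - x div k \<le> y - y div k"
proof -
  have "y div k - x div k \<le> y - x"
  proof -
    have "y div k \<le> (x + k * (y - x)) div k"
      using assms mult_right_mono[of 1 k "y - x"] by (intro zdiv_mono1) auto
    then show ?thesis using assms by simp
  qed
  then show ?thesis by simp
qed

text \<open>Up to the renumbering of positions, \<open>unrolled (Suc d)\<close> consists of window sums of
  \<open>unrolled d\<close>. The renumbering turns the shift by one full block of length \<open>d + 2\<close> into a shift by
  \<open>d + 1\<close>, so the hypothesis of \<open>window_sum_ratio_mono\<close> is exactly the induction hypothesis.\<close>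

lemma unrolled_ratio_mono:
  "x \<le> y \<Longrightarrow> unrolled d x * unrolled d (y + (int d + 1)) \<le> unrolled d y * unrolled d (x + (int d + 1))"
proof (induction d arbitrary: x y)
  case 0
  then show ?case by simp
next
  case (Suc d)
  define n where "n = int d + 1"
  define a where "a p = p - p div (int d + 2)" for p
  have shift: "a (p + (int d + 2)) = a p + n" for p by (simp add: a_def n_def)
  have win: "unrolled (Suc d) p = (\<Sum>q\<in>{a p - n..<a p}. unrolled d q)" for p
    by (simp add: unrolled.simps(2) Let_def a_def n_def)
  have win': "unrolled (Suc d) (p + (int (Suc d) + 1)) = (\<Sum>q\<in>{a p - n..<a p}. unrolled d (q + n))" for p
  proof -
    have "int (Suc d) + 1 = int d + 2" by simp
    then have "unrolled (Suc d) (p + (int (Suc d) + 1)) = (\<Sum>q\<in>{a p..<a p + n}. unrolled d q)"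
      using win[of "p + (int d + 2)"] by (simp only: shift) simp
    also have "\<dots> = (\<Sum>q\<in>{a p - n..<a p}. unrolled d (q + n))"
      by (rule sum.reindex_bij_witness[of _ "\<lambda>q. q + n" "\<lambda>q. q - n"]) auto
    finally show ?thesis .
  qed
  have "a x \<le> a y" unfolding a_def using Suc.prems by (intro shift_position_mono) auto
  then show ?case unfolding win' win[of x] win[of y]
    using Suc.IH by (intro window_sum_ratio_mono) (simp_all add: n_def)
qed

lemma unrolled_nonneg: "0 \<le> unrolled d p"
  by (induction d arbitrary: p) (simp_all add: unrolled.simps(2) Let_def sum_nonneg)

lemma unrolled_eq_0: "p < int d \<Longrightarrow> unrolled d p = 0"
proof (induction d arbitrary: p)
  case (Suc d)
  have "p - p div (int d + 2) \<le> int d - int d div (int d + 2)"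
    using Suc.prems by (intro shift_position_mono) auto
  then have "p - p div (int d + 2) \<le> int d" by simp
  then show ?case by (simp add: unrolled.simps(2) Let_def Suc.IH)
qed simp

lemma unrolled_pos:
  assumes "int d \<le> p" "p \<le> int d * (int d + 1)"
  shows "0 < unrolled d p"
  using assms
proof (induction d arbitrary: p)
  case (Suc d)
  define a where "a = p - p div (int d + 2)"
  have "(int d + 1) - (int d + 1) div (int d + 2) \<le> a"
    unfolding a_def using Suc.prems by (intro shift_position_mono) auto
  then have lo: "int d + 1 \<le> a" by simp
  have "a \<le> (int d + 1) * (int d + 2) - (int d + 1) * (int d + 2) div (int d + 2)"
    unfolding a_def using Suc.prems by (intro shift_position_mono) (auto simp: algebra_simps)
  then have "a \<le> (int d + 1) * (int d + 2) - (int d + 1)" by simp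
  then have hi: "a - (int d + 1) \<le> int d * (int d + 1)" by (simp add: algebra_simps)
  \<comment> \<open>The window has \<open>d + 1\<close> entries, so it meets the support of level \<open>d\<close> in its own first entry or
    in the first entry of that support.\<close>
  define q where "q = max (int d) (a - (int d + 1))"
  have "int d \<le> int d * (int d + 1)" by (simp add: algebra_simps)
  with hi have "0 < unrolled d q" by (intro Suc.IH) (auto simp: q_def)
  moreover have "q \<in> {a - (int d + 1)..<a}" using lo by (auto simp: q_def)
  ultimately have "0 < (\<Sum>q\<in>{a - (int d + 1)..<a}. unrolled d q)"
    by (intro sum_pos2[of _ q]) (auto simp: unrolled_nonneg)
  then show ?case by (simp add: unrolled.simps(2) Let_def a_def)
qed simp

lemma unrolled_block_start_pos:
  assumes "1 \<le> e" "e \<le> d"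
  shows "0 < unrolled d (int e * (int d + 1))"
proof -
  have "int d \<le> 1 * (int d + 1)" by simp
  also have "1 * (int d + 1) \<le> int e * (int d + 1)" using assms by (intro mult_right_mono) auto
  finally have "int d \<le> int e * (int d + 1)" .
  moreover have "int e * (int d + 1) \<le> int d * (int d + 1)"
    using assms by (intro mult_right_mono) auto
  ultimately show ?thesis by (rule unrolled_pos)
qed

lemma unrolled_first_pos: "0 < unrolled d (int d)"
  by (intro unrolled_pos) (simp_all add: algebra_simps)

text \<open>The reflection of positions on level \<open>d + 1\<close> maps windows to reflected windows on level
  \<open>d\<close>. In matrix terms this is the rotation by 180 degrees.\<close>

lemma unrolled_symmetric: "unrolled d (int d * (int d + 2) - p) = unrolled d p"
proof (induction d arbitrary: p)
  case (Suc d)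
  define n e r where "n = int d + 1" and "e = p div (int d + 2)" and "r = p mod (int d + 2)"
  have p: "p = e * (int d + 2) + r" by (simp only: e_def r_def div_mult_mod_eq)
  have r: "0 \<le> r" "r \<le> int d + 1"
    using pos_mod_bound[of "int d + 2" p] pos_mod_sign[of "int d + 2" p] unfolding r_def by linarith+
  have "int (Suc d) * (int (Suc d) + 2) - p = (n - e) * (int d + 2) + (n - r)"
    unfolding p n_def by (simp add: algebra_simps)
  then have "unrolled (Suc d) (int (Suc d) * (int (Suc d) + 2) - p) =
      (\<Sum>q\<in>{(n - e - 1) * n + (n - r)..<(n - e) * n + (n - r)}. unrolled d q)"
    using unrolled_Suc[of "n - r" d "n - e"] r by (simp add: n_def)
  also have "\<dots> = (\<Sum>q\<in>{(e - 1) * n + r..<e * n + r}. unrolled d (int d * (int d + 2) - q))"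
    by (rule sum.reindex_bij_witness[of _ "\<lambda>q. int d * (int d + 2) - q" "\<lambda>q. int d * (int d + 2) - q"])
       (auto simp: n_def algebra_simps)
  also have "\<dots> = unrolled (Suc d) p"
    unfolding p unrolled_Suc[OF r] by (simp add: Suc.IH n_def)
  finally show ?case .
qed (auto simp: of_bool_def)

section \<open>Counting chains of faces\<close>

text \<open>The number of chains of \<open>i\<close> nonempty subsets of a \<open>k\<close>-element set whose largest member is the
  whole set. It equals \<open>i!\<close> times a Stirling number of the second kind; the recursion removes
  the largest member.\<close>

primrec chain_count :: "nat \<Rightarrow> nat \<Rightarrow> nat" where
  "chain_count 0 k = of_bool (k = 0)"
| "chain_count (Suc i) k = (\<Sum>l<k. (k choose l) * chain_count i l)"

lemma chain_count_eq_0: "k < i \<Longrightarrow> chain_count i k = 0"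
  by (induction i arbitrary: k) auto

lemma sum_choose_chain_count:
  "(\<Sum>l\<le>k. (k choose l) * chain_count i l) = chain_count i k + chain_count (Suc i) k"
  by (simp add: lessThan_Suc_atMost[symmetric])

definition full_chains :: "'a set \<Rightarrow> nat \<Rightarrow> 'a set set set" where
  "full_chains F i = {C. subset.chain (Pow F - {{}}) C \<and> \<Union>C = F \<and> card C = i}"

lemma finite_full_chains: "finite F \<Longrightarrow> finite (full_chains F i)"
  by (rule finite_subset[of _ "Pow (Pow F)"]) (auto simp: full_chains_def subset_chain_def)

lemma finite_member_full_chains: "finite F \<Longrightarrow> C \<in> full_chains F i \<Longrightarrow> finite C"
  by (rule finite_subset[of _ "Pow F"]) (auto simp: full_chains_def)

lemma full_chains_disjoint: "F \<noteq> G \<Longrightarrow> full_chains F i \<inter> full_chains G i = {}"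
  by (auto simp: full_chains_def)

lemma full_chains_Suc:
  assumes "finite F"
  shows "full_chains F (Suc i) = insert F ` (\<Union>G\<in>{G. G \<subset> F}. full_chains G i)"
proof (intro equalityI subsetI)
  fix C assume C: "C \<in> full_chains F (Suc i)"
  then have ch: "subset.chain (Pow F - {{}}) C" and un: "\<Union>C = F" and card: "card C = Suc i"
    by (auto simp: full_chains_def)
  have fin: "finite C" using finite_member_full_chains[OF assms C] .
  have "C \<noteq> {}" using card by auto
  then have "F \<in> C" using Union_in_chain[OF fin _ ch] un by simp
  define D where "D = C - {F}"
  have sub: "subset.chain (Pow F - {{}}) D" using ch by (auto simp: D_def subset_chain_def)
  have "\<Union>D \<noteq> F"
  proof (cases "D = {}")
    case True
    then show ?thesis using \<open>F \<in> C\<close> ch by (auto simp: subset_chain_def)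
  next
    case False
    then have "\<Union>D \<in> D" using Union_in_chain[OF _ _ sub] fin by (simp add: D_def)
    then show ?thesis by (auto simp: D_def)
  qed
  then have "\<Union>D \<subset> F" using un by (auto simp: D_def)
  moreover have "D \<in> full_chains (\<Union>D) i"
    using sub card \<open>F \<in> C\<close> by (auto simp: full_chains_def subset_chain_def D_def)
  moreover have "C = insert F D" using \<open>F \<in> C\<close> by (auto simp: D_def)
  ultimately show "C \<in> insert F ` (\<Union>G\<in>{G. G \<subset> F}. full_chains G i)" by blast
next
  fix C assume "C \<in> insert F ` (\<Union>G\<in>{G. G \<subset> F}. full_chains G i)"
  then obtain G D where G: "G \<subset> F" and D: "D \<in> full_chains G i" and C: "C = insert F D" by blast
  have "finite D" using D G assms finite_member_full_chains finite_subset by blast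
  have "F \<notin> D" "F \<noteq> {}" using G D by (auto simp: full_chains_def)
  have ch: "D \<subseteq> Pow G - {{}}" "\<forall>X\<in>D. \<forall>Y\<in>D. X \<subseteq> Y \<or> Y \<subseteq> X"
    using D by (simp_all add: full_chains_def subset_chain_def)
  have "subset.chain (Pow F - {{}}) C"
    using ch G \<open>F \<noteq> {}\<close> unfolding C subset_chain_def by blast
  moreover have "\<Union>C = F" using ch G unfolding C by blast
  moreover have "card C = Suc i"
    using D \<open>finite D\<close> \<open>F \<notin> D\<close> by (simp add: C full_chains_def)
  ultimately show "C \<in> full_chains F (Suc i)" by (simp add: full_chains_def)
qed

lemma card_full_chains: "finite F \<Longrightarrow> card (full_chains F i) = chain_count i (card F)"
proof (induction i arbitrary: F)
  case 0
  have "full_chains F 0 = (if F = {} then {{}} else {})"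
  proof -
    have "C \<in> full_chains F 0 \<longleftrightarrow> C = {} \<and> F = {}" for C
    proof
      assume C: "C \<in> full_chains F 0"
      then have "C = {}"
        using finite_member_full_chains[OF 0 C] by (simp add: full_chains_def)
      with C show "C = {} \<and> F = {}" by (simp add: full_chains_def)
    qed (simp add: full_chains_def subset_chain_def)
    then show ?thesis by auto
  qed
  then show ?case using 0 by simp
next
  case (Suc i)
  have fin: "finite G" if "G \<subset> F" for G using that Suc.prems finite_subset by blast
  have fins: "finite {G. G \<subset> F}"
    by (rule finite_subset[of _ "Pow F"]) (use Suc.prems in auto)
  have notin: "F \<notin> D" if "G \<subset> F" "D \<in> full_chains G i" for G D
    using that by (auto simp: full_chains_def)
  have "card (full_chains F (Suc i)) = card (\<Union>G\<in>{G. G \<subset> F}. full_chains G i)"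
    unfolding full_chains_Suc[OF Suc.prems]
  proof (intro card_image inj_onI)
    fix C D
    assume "C \<in> (\<Union>G\<in>{G. G \<subset> F}. full_chains G i)" "D \<in> (\<Union>G\<in>{G. G \<subset> F}. full_chains G i)"
      and "insert F C = insert F D"
    moreover from this have "F \<notin> C" "F \<notin> D" using notin by auto
    ultimately show "C = D" by (simp add: insert_ident)
  qed
  also have "\<dots> = (\<Sum>G\<in>{G. G \<subset> F}. card (full_chains G i))"
    using fins fin by (intro card_UN_disjoint) (simp_all add: finite_full_chains full_chains_disjoint)
  also have "\<dots> = (\<Sum>G\<in>{G. G \<subset> F}. chain_count i (card G))"
    using Suc.IH fin by (intro sum.cong) auto
  also have "\<dots> = (\<Sum>l<card F. \<Sum>G\<in>{G. G \<in> {G. G \<subset> F} \<and> card G = l}. chain_count i (card G))"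
    using fins Suc.prems by (intro sum.group[symmetric] image_subsetI) (simp_all add: psubset_card_mono)
  also have "\<dots> = (\<Sum>l<card F. (card F choose l) * chain_count i l)"
  proof (intro sum.cong refl)
    fix l assume "l \<in> {..<card F}"
    then have "{G. G \<in> {G. G \<subset> F} \<and> card G = l} = {G. G \<subseteq> F \<and> card G = l}" by auto
    then show "(\<Sum>G\<in>{G. G \<in> {G. G \<subset> F} \<and> card G = l}. chain_count i (card G))
        = (card F choose l) * chain_count i l"
      using n_subsets[OF Suc.prems, of l] by simp
  qed
  finally show ?case by simp
qed

lemma f_vec_eq_card: "f_vec \<Delta> (int i - 1) = card {F \<in> \<Delta>. card F = i}"
  by (simp add: f_vec_def face_dim_def)

lemma card_le_complex_dim:
  assumes "simplicial_complex \<Delta>" "complex_dim \<Delta> = int d - 1" "F \<in> \<Delta>"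
  shows "card F \<le> d"
proof -
  have "face_dim F \<le> complex_dim \<Delta>"
    unfolding complex_dim_def using assms(1,3)
    by (intro Max_ge finite_imageI imageI) (simp_all add: simplicial_complex_def)
  then show ?thesis using assms(2) by (simp add: face_dim_def)
qed

text \<open>Chains are sorted by their largest member, which is their union.\<close>

lemma f_vec_barycentric_subdivision:
  assumes "simplicial_complex \<Delta>" "complex_dim \<Delta> = int d - 1"
  shows "f_vec (barycentric_subdivision \<Delta>) (int i - 1)
       = (\<Sum>k\<le>d. f_vec \<Delta> (int k - 1) * chain_count i k)"
proof -
  have fin: "finite \<Delta>" and fF: "\<And>F. F \<in> \<Delta> \<Longrightarrow> finite F"
    and down: "\<And>F G. F \<in> \<Delta> \<Longrightarrow> G \<subseteq> F \<Longrightarrow> G \<in> \<Delta>" and "{} \<in> \<Delta>"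
    using assms(1) by (auto simp: simplicial_complex_def)
  have "{C \<in> barycentric_subdivision \<Delta>. card C = i} = (\<Union>F\<in>\<Delta>. full_chains F i)"
  proof (intro equalityI subsetI)
    fix C assume "C \<in> {C \<in> barycentric_subdivision \<Delta>. card C = i}"
    then have ch: "subset.chain (\<Delta> - {{}}) C" and "card C = i"
      by (auto simp: barycentric_subdivision_def)
    then have "finite C" using fin finite_subset[of C \<Delta>] by (auto simp: subset_chain_def)
    then have "\<Union>C \<in> \<Delta>"
      using Union_in_chain[OF _ _ ch] ch \<open>{} \<in> \<Delta>\<close> by (cases "C = {}") (auto simp: subset_chain_def)
    moreover have "C \<in> full_chains (\<Union>C) i"
      using ch \<open>card C = i\<close> by (auto simp: full_chains_def subset_chain_def)
    ultimately show "C \<in> (\<Union>F\<in>\<Delta>. full_chains F i)" by blast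
  next
    fix C assume "C \<in> (\<Union>F\<in>\<Delta>. full_chains F i)"
    then obtain F where "F \<in> \<Delta>" "C \<in> full_chains F i" by blast
    then show "C \<in> {C \<in> barycentric_subdivision \<Delta>. card C = i}"
      using down unfolding full_chains_def barycentric_subdivision_def subset_chain_def by blast
  qed
  then have "f_vec (barycentric_subdivision \<Delta>) (int i - 1) = card (\<Union>F\<in>\<Delta>. full_chains F i)"
    by (simp add: f_vec_eq_card)
  also have "\<dots> = (\<Sum>F\<in>\<Delta>. card (full_chains F i))"
    using fin fF by (intro card_UN_disjoint) (simp_all add: finite_full_chains full_chains_disjoint)
  also have "\<dots> = (\<Sum>F\<in>\<Delta>. chain_count i (card F))"
    using fF by (intro sum.cong) (auto simp: card_full_chains)
  also have "\<dots> = (\<Sum>k\<le>d. \<Sum>F\<in>{F. F \<in> \<Delta> \<and> card F = k}. chain_count i (card F))"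
    using fin card_le_complex_dim[OF assms] by (intro sum.group[symmetric]) auto
  also have "\<dots> = (\<Sum>k\<le>d. f_vec \<Delta> (int k - 1) * chain_count i k)"
    by (intro sum.cong) (auto simp: f_vec_eq_card)
  finally show ?thesis .
qed

section \<open>The rows of the transformation matrix\<close>

text \<open>The contribution of one \<open>k\<close>-element face to the \<open>h\<close>-polynomial of the subdivision.\<close>

definition sd_face :: "nat \<Rightarrow> nat \<Rightarrow> int poly" where
  "sd_face d k = (\<Sum>i\<le>d. smult (int (chain_count i k)) ([:-1, 1:] ^ (d - i)))"

text \<open>The contribution of a unit of \<open>h\<^sub>r\<close>, since \<open>f\<^bsub>k-1\<^esub>\<close> is the sum over \<open>r\<close> of
  \<open>(d - r choose d - k) h\<^sub>r\<close>.\<close>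

definition sd_row :: "nat \<Rightarrow> nat \<Rightarrow> int poly" where
  "sd_row d r = (\<Sum>k\<le>d. smult (int ((d - r) choose (d - k))) (sd_face d k))"

lemma smult_sum_right: "smult c (\<Sum>i\<in>S. f i) = (\<Sum>i\<in>S. smult c (f i))"
  by (induction S rule: infinite_finite_induct) (simp_all add: smult_add_right)

lemma sd_face_Suc:
  assumes "k \<le> d"
  shows "sd_face (Suc d) k = [:-1, 1:] * sd_face d k"
proof -
  have "sd_face (Suc d) k = (\<Sum>i\<le>d. smult (int (chain_count i k)) ([:-1, 1:] ^ (Suc d - i)))"
    using assms by (simp only: sd_face_def sum.atMost_Suc chain_count_eq_0[of k "Suc d"]) simp
  also have "\<dots> = (\<Sum>i\<le>d. [:-1, 1:] * smult (int (chain_count i k)) ([:-1, 1:] ^ (d - i)))"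
    by (intro sum.cong refl) (simp add: Suc_diff_le del: mult_pCons_left)
  finally show ?thesis by (simp only: sd_face_def sum_distrib_left)
qed

lemma sd_row_last: "sd_row d d = sd_face d d"
proof -
  have "sd_row d d = (\<Sum>k\<le>d. if k = d then sd_face d k else 0)"
    unfolding sd_row_def by (intro sum.cong) auto
  then show ?thesis by simp
qed

text \<open>Pascal's rule; the term \<open>k = d + 1\<close> cancels.\<close>

lemma sd_row_diff:
  assumes "r \<le> d"
  shows "sd_row (Suc d) r - sd_row (Suc d) (Suc r) = [:-1, 1:] * sd_row d r"
proof -
  have "sd_row (Suc d) r - sd_row (Suc d) (Suc r) =
     (\<Sum>k\<le>Suc d. smult (int ((Suc d - r) choose (Suc d - k)) - int ((d - r) choose (Suc d - k)))
        (sd_face (Suc d) k))"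
    unfolding sd_row_def by (simp only: sum_subtractf[symmetric] smult_diff_left diff_Suc_Suc)
  also have "\<dots> = (\<Sum>k\<le>d. smult (int ((Suc d - r) choose (Suc d - k)) - int ((d - r) choose (Suc d - k)))
        (sd_face (Suc d) k))"
    by simp
  also have "\<dots> = (\<Sum>k\<le>d. [:-1, 1:] * smult (int ((d - r) choose (d - k))) (sd_face d k))"
    using assms by (intro sum.cong refl) (simp add: Suc_diff_le sd_face_Suc del: mult_pCons_left)
  finally show ?thesis by (simp only: sd_row_def sum_distrib_left)
qed

text \<open>Both sides enumerate chains of subsets of a \<open>d\<close>-element set: by \<open>sum_choose_chain_count\<close>
  the left side counts those with arbitrary union, and such a chain either has the whole set as
  its top element or becomes so after that set is added, which lowers the exponent of \<open>x - 1\<close> by one.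
  The two cases contribute \<open>1\<close> and \<open>x - 1\<close> times the right-hand factor. For \<open>d = 0\<close> the whole set
  is empty and cannot be added.\<close>

lemma sd_row_first:
  assumes "d \<ge> 1"
  shows "sd_row d 0 = [:0, 1:] * sd_row d d"
proof -
  let ?y = "[:-1, 1:] :: int poly"
  have "sd_row d 0 = (\<Sum>k\<le>d. \<Sum>i\<le>d. smult (int ((d choose k) * chain_count i k)) (?y ^ (d - i)))"
    unfolding sd_row_def sd_face_def
    by (intro sum.cong refl) (simp add: smult_sum_right binomial_symmetric[symmetric])
  also have "\<dots> = (\<Sum>i\<le>d. smult (int (\<Sum>k\<le>d. (d choose k) * chain_count i k)) (?y ^ (d - i)))"
    by (subst sum.swap) (simp add: smult_sum)
  also have "\<dots> = sd_face d d + (\<Sum>i\<le>d. smult (int (chain_count (Suc i) d)) (?y ^ (d - i)))"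
    by (simp only: sum_choose_chain_count of_nat_add smult_add_left sum.distrib sd_face_def)
  also have "(\<Sum>i\<le>d. smult (int (chain_count (Suc i) d)) (?y ^ (d - i)))
      = (\<Sum>i<d. smult (int (chain_count (Suc i) d)) (?y ^ (d - i)))"
    by (simp only: lessThan_Suc_atMost[symmetric] sum.lessThan_Suc chain_count_eq_0[OF lessI]) simp
  also have "\<dots> = (\<Sum>i<d. ?y * smult (int (chain_count (Suc i) d)) (?y ^ (d - Suc i)))"
    by (intro sum.cong refl) (simp add: Suc_diff_Suc[symmetric] del: mult_pCons_left)
  also have "\<dots> = ?y * (\<Sum>i<d. smult (int (chain_count (Suc i) d)) (?y ^ (d - Suc i)))"
    by (simp only: sum_distrib_left)
  also have "(\<Sum>i<d. smult (int (chain_count (Suc i) d)) (?y ^ (d - Suc i))) = sd_face d d"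
    unfolding sd_face_def lessThan_Suc_atMost[symmetric] sum.lessThan_Suc_shift
    using assms by simp
  also have "sd_face d d + ?y * sd_face d d = [:0, 1:] * sd_face d d" by simp
  finally show ?thesis by (simp only: sd_row_last)
qed

text \<open>Summing \<open>sd_row_diff\<close> expresses all rows through row \<open>0\<close>, and \<open>sd_row_first\<close> then
  determines row \<open>0\<close>.\<close>

lemma sd_row_Suc:
  assumes "r \<le> Suc d"
  shows "sd_row (Suc d) r = [:0, 1:] * (\<Sum>s=r..d. sd_row d s) + (\<Sum>s<r. sd_row d s)"
proof -
  define S where "S = (\<Sum>s\<le>d. sd_row d s)"
  have telescope: "sd_row (Suc d) 0 - sd_row (Suc d) t = [:-1, 1:] * (\<Sum>s<t. sd_row d s)"
    if "t \<le> Suc d" for t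
  proof -
    have "sd_row (Suc d) 0 - sd_row (Suc d) t = (\<Sum>s<t. sd_row (Suc d) s - sd_row (Suc d) (Suc s))"
      by (rule sum_lessThan_telescope'[symmetric])
    also have "\<dots> = (\<Sum>s<t. [:-1, 1:] * sd_row d s)"
      using that by (intro sum.cong refl sd_row_diff) auto
    finally show ?thesis by (simp only: sum_distrib_left)
  qed
  have "[:-1, 1:] * sd_row (Suc d) (Suc d) = [:-1, 1:] * S"
    using telescope[of "Suc d"] sd_row_first[of "Suc d"] by (simp add: S_def lessThan_Suc_atMost)
  then have "sd_row (Suc d) (Suc d) = S" by (subst (asm) mult_cancel_left) auto
  then have "sd_row (Suc d) 0 = [:0, 1:] * S" using sd_row_first[of "Suc d"] by simp
  then have "sd_row (Suc d) r = [:0, 1:] * S - [:-1, 1:] * (\<Sum>s<r. sd_row d s)"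
    using telescope[OF assms] by (simp add: algebra_simps)
  moreover have "S = (\<Sum>s<r. sd_row d s) + (\<Sum>s=r..d. sd_row d s)"
    unfolding S_def using assms
    by (subst sum.union_disjoint[symmetric]) (auto intro!: sum.cong)
  ultimately show ?thesis by (simp add: smult_add_right)
qed

lemma coeff_sd_row:
  "r \<le> d \<Longrightarrow> coeff (sd_row d r) e = unrolled d (int e * (int d + 1) + int r)"
proof (induction d arbitrary: r e)
  case 0
  then show ?case by (cases e) (simp_all add: sd_row_def sd_face_def)
next
  case (Suc d)
  define n where "n = int d + 1"
  have lower: "coeff ([:0, 1:] * (\<Sum>s=r..d. sd_row d s)) e
      = (\<Sum>q\<in>{(int e - 1) * n + int r..<int e * n}. unrolled d q)"
  proof (cases e)
    case 0
    then show ?thesis by (simp add: unrolled_eq_0)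
  next
    case (Suc e')
    have "(\<Sum>s=r..d. unrolled d (int e' * n + int s))
        = (\<Sum>q\<in>{(int e - 1) * n + int r..<int e * n}. unrolled d q)"
      by (rule sum.reindex_bij_witness[of _ "\<lambda>q. nat (q - int e' * n)" "\<lambda>s. int e' * n + int s"])
         (auto simp: Suc n_def algebra_simps)
    then show ?thesis by (simp add: Suc coeff_sum Suc.IH n_def)
  qed
  have upper: "coeff (\<Sum>s<r. sd_row d s) e = (\<Sum>q\<in>{int e * n..<int e * n + int r}. unrolled d q)"
  proof -
    have "(\<Sum>s<r. unrolled d (int e * n + int s)) = (\<Sum>q\<in>{int e * n..<int e * n + int r}. unrolled d q)"
      by (rule sum.reindex_bij_witness[of _ "\<lambda>q. nat (q - int e * n)" "\<lambda>s. int e * n + int s"]) auto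
    then show ?thesis using Suc.prems by (simp add: coeff_sum Suc.IH n_def)
  qed
  have "coeff (sd_row (Suc d) r) e = (\<Sum>q\<in>{(int e - 1) * n + int r..<int e * n + int r}. unrolled d q)"
    unfolding sd_row_Suc[OF Suc.prems] coeff_add lower upper
    using Suc.prems by (subst sum.union_disjoint[symmetric]) (auto simp: n_def algebra_simps intro!: sum.cong)
  also have "\<dots> = unrolled (Suc d) (int e * (int d + 2) + int r)"
    using Suc.prems by (subst unrolled_Suc) (auto simp: n_def)
  finally show ?case by (simp add: algebra_simps)
qed

section \<open>The h-vector of the subdivision\<close>

text \<open>Substitute \<open>x + 1\<close> for \<open>x\<close> in the defining identity of the \<open>h\<close>-vector and compare
  coefficients.\<close>

lemma f_vec_eq_sum_h_vec:
  assumes "complex_dim \<Delta> = int d - 1" "k \<le> d"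
  shows "int (f_vec \<Delta> (int k - 1)) = (\<Sum>r\<le>d. h_vec \<Delta> r * int ((d - r) choose (d - k)))"
proof -
  have power: "pcompose (p ^ n) q = pcompose p q ^ n" for p q :: "int poly" and n
    by (induction n) (simp_all add: pcompose_1 pcompose_mult)
  have d: "nat (complex_dim \<Delta> + 1) = d" using assms by simp
  have "(\<Sum>i\<le>d. smult (int (f_vec \<Delta> (int i - 1))) ([:-1, 1:] ^ (d - i)))
      = (\<Sum>i\<le>d. smult (h_vec \<Delta> i) ([:0, 1:] ^ (d - i)))"
    using h_vec_identity[of \<Delta>] unfolding d by (simp add: monom_altdef)
  then have "pcompose (\<Sum>i\<le>d. smult (int (f_vec \<Delta> (int i - 1))) ([:-1, 1:] ^ (d - i))) [:1, 1:]
      = pcompose (\<Sum>i\<le>d. smult (h_vec \<Delta> i) ([:0, 1:] ^ (d - i))) [:1, 1:]" by simp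
  then have "(\<Sum>i\<le>d. smult (int (f_vec \<Delta> (int i - 1))) ([:0, 1:] ^ (d - i)))
      = (\<Sum>i\<le>d. smult (h_vec \<Delta> i) ([:1, 1:] ^ (d - i)))"
    by (simp add: pcompose_sum pcompose_smult power pcompose_pCons)
  then have "coeff (\<Sum>i\<le>d. monom (int (f_vec \<Delta> (int i - 1))) (d - i)) (d - k)
      = coeff (\<Sum>i\<le>d. smult (h_vec \<Delta> i) ([:1, 1:] ^ (d - i))) (d - k)"
    by (simp add: monom_altdef)
  moreover have "coeff ([:1, 1:] ^ n) m = int (n choose m)" for n m
  proof (cases "m \<le> n")
    case True
    then show ?thesis by (simp add: coeff_linear_poly_power)
  next
    case False
    have "degree ([:1, 1::int:] ^ n) \<le> n"
      using degree_power_le[of "[:1, 1::int:]" n] by simp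
    with False show ?thesis by (simp add: coeff_eq_0 binomial_eq_0)
  qed
  moreover have "coeff (\<Sum>i\<le>d. monom (int (f_vec \<Delta> (int i - 1))) (d - i)) (d - k)
      = (\<Sum>i\<le>d. if i = k then int (f_vec \<Delta> (int i - 1)) else 0)"
    unfolding coeff_sum using assms(2) by (intro sum.cong) auto
  ultimately show ?thesis using assms(2) by (simp add: coeff_sum)
qed

lemma h_vec_0:
  assumes "simplicial_complex \<Delta>" "complex_dim \<Delta> = int d - 1"
  shows "h_vec \<Delta> 0 = 1"
proof -
  have "{F \<in> \<Delta>. card F = 0} = {{}}"
    using assms(1) by (auto simp: simplicial_complex_def)
  then have "f_vec \<Delta> (int 0 - 1) = 1" unfolding f_vec_eq_card by simp
  moreover have "(\<Sum>r\<le>d. h_vec \<Delta> r * int ((d - r) choose (d - 0))) = (\<Sum>r\<le>d. if r = 0 then h_vec \<Delta> r else 0)"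
    by (intro sum.cong) auto
  ultimately show ?thesis using f_vec_eq_sum_h_vec[OF assms(2), of 0] by simp
qed

lemma h_vec_barycentric_subdivision:
  assumes "simplicial_complex \<Delta>" "complex_dim \<Delta> = int d - 1" "j \<le> d"
  shows "h_vec (barycentric_subdivision \<Delta>) j
       = (\<Sum>r\<le>d. h_vec \<Delta> r * unrolled d (int (d - j) * (int d + 1) + int r))"
proof -
  have d: "nat (complex_dim (barycentric_subdivision \<Delta>) + 1) = d"
    using complex_dim_barycentric_subdivision[OF assms(1)] assms(2) by simp
  have "h_poly (barycentric_subdivision \<Delta>)
      = (\<Sum>i\<le>d. \<Sum>k\<le>d. smult (int (f_vec \<Delta> (int k - 1))) (smult (int (chain_count i k)) ([:-1, 1:] ^ (d - i))))"
    unfolding h_poly_def d Let_def f_vec_barycentric_subdivision[OF assms(1,2)]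
    by (simp add: smult_sum)
  also have "\<dots> = (\<Sum>k\<le>d. smult (int (f_vec \<Delta> (int k - 1))) (sd_face d k))"
    by (subst sum.swap) (simp only: sd_face_def smult_sum_right)
  also have "\<dots> = (\<Sum>k\<le>d. \<Sum>r\<le>d. smult (h_vec \<Delta> r) (smult (int ((d - r) choose (d - k))) (sd_face d k)))"
    by (intro sum.cong refl) (simp add: f_vec_eq_sum_h_vec[OF assms(2)] smult_sum)
  also have "\<dots> = (\<Sum>r\<le>d. smult (h_vec \<Delta> r) (sd_row d r))"
    by (subst sum.swap) (simp only: sd_row_def smult_sum_right)
  finally have "h_vec (barycentric_subdivision \<Delta>) j
      = coeff (\<Sum>r\<le>d. smult (h_vec \<Delta> r) (sd_row d r)) (d - j)"
    using assms(3) by (simp add: h_vec_def d)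
  then show ?thesis by (simp add: coeff_sum coeff_sd_row)
qed

lemma h_vec_barycentric_subdivision_reversed:
  assumes "simplicial_complex \<Delta>" "complex_dim \<Delta> = int d - 1" "j \<le> d"
  shows "h_vec (barycentric_subdivision \<Delta>) (d - j)
       = (\<Sum>r\<le>d. h_vec \<Delta> (d - r) * unrolled d (int (d - j) * (int d + 1) + int r))"
proof -
  have "h_vec (barycentric_subdivision \<Delta>) (d - j)
      = (\<Sum>r\<le>d. h_vec \<Delta> r * unrolled d (int j * (int d + 1) + int r))"
    using h_vec_barycentric_subdivision[OF assms(1,2), of "d - j"] assms(3) by simp
  also have "\<dots> = (\<Sum>r\<le>d. h_vec \<Delta> (d - r) * unrolled d (int j * (int d + 1) + int (d - r)))"
    by (rule sum.reindex_bij_witness[of _ "\<lambda>r. d - r" "\<lambda>r. d - r"]) auto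
  also have "\<dots> = (\<Sum>r\<le>d. h_vec \<Delta> (d - r) * unrolled d (int (d - j) * (int d + 1) + int r))"
  proof (intro sum.cong refl)
    fix r assume "r \<in> {..d}"
    then have "int j * (int d + 1) + int (d - r) = int d * (int d + 2) - (int (d - j) * (int d + 1) + int r)"
      using assms(3) by (simp add: of_nat_diff algebra_simps)
    then show "h_vec \<Delta> (d - r) * unrolled d (int j * (int d + 1) + int (d - r))
        = h_vec \<Delta> (d - r) * unrolled d (int (d - j) * (int d + 1) + int r)"
      by (simp only: unrolled_symmetric)
  qed
  finally show ?thesis .
qed

section \<open>Monotonicity is inherited\<close>

lemma unrolled_blocks_ratio_mono:
  assumes "j < d" "r \<le> s"
  shows "unrolled d (int (d - Suc j) * (int d + 1) + int r) * unrolled d (int (d - j) * (int d + 1) + int s)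
    \<le> unrolled d (int (d - Suc j) * (int d + 1) + int s) * unrolled d (int (d - j) * (int d + 1) + int r)"
proof -
  have block: "int (d - j) * (int d + 1) + t = (int (d - Suc j) * (int d + 1) + t) + (int d + 1)" for t
    using assms(1) by (simp add: of_nat_diff algebra_simps)
  show ?thesis
    unfolding block using assms(2) by (intro unrolled_ratio_mono) simp
qed

lemma h_ratio_mono_barycentric_subdivision:
  assumes "simplicial_complex \<Delta>" "complex_dim \<Delta> = int d - 1" "j < d"
    and mono: "\<And>r s. r \<le> s \<Longrightarrow> s \<le> d \<Longrightarrow>
      h_vec \<Delta> r * h_vec \<Delta> (d - s) \<le> h_vec \<Delta> s * h_vec \<Delta> (d - r)"
  shows "h_vec (barycentric_subdivision \<Delta>) j * h_vec (barycentric_subdivision \<Delta>) (d - Suc j)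
    \<le> h_vec (barycentric_subdivision \<Delta>) (Suc j) * h_vec (barycentric_subdivision \<Delta>) (d - j)"
proof -
  have "j \<le> d" "Suc j \<le> d" using assms(3) by auto
  note g = this[THEN h_vec_barycentric_subdivision[OF assms(1,2)]]
    this[THEN h_vec_barycentric_subdivision_reversed[OF assms(1,2)]]
  show ?thesis
    unfolding g using assms(3) by (intro sum_ratio_mono mono unrolled_blocks_ratio_mono) simp_all
qed

text \<open>Monotone decreasing ratios become increasing when \<open>h\<close> and its reversal change places.\<close>

lemma h_ratio_antimono_barycentric_subdivision:
  assumes "simplicial_complex \<Delta>" "complex_dim \<Delta> = int d - 1" "j < d"
    and antimono: "\<And>r s. r \<le> s \<Longrightarrow> s \<le> d \<Longrightarrow>
      h_vec \<Delta> s * h_vec \<Delta> (d - r) \<le> h_vec \<Delta> r * h_vec \<Delta> (d - s)"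
  shows "h_vec (barycentric_subdivision \<Delta>) (Suc j) * h_vec (barycentric_subdivision \<Delta>) (d - j)
    \<le> h_vec (barycentric_subdivision \<Delta>) j * h_vec (barycentric_subdivision \<Delta>) (d - Suc j)"
proof -
  let ?v = "\<lambda>r. unrolled d (int (d - j) * (int d + 1) + int r)"
  let ?u = "\<lambda>r. unrolled d (int (d - Suc j) * (int d + 1) + int r)"
  have "j \<le> d" "Suc j \<le> d" using assms(3) by auto
  note g = this[THEN h_vec_barycentric_subdivision[OF assms(1,2)]]
    this[THEN h_vec_barycentric_subdivision_reversed[OF assms(1,2)]]
  have "(\<Sum>r\<le>d. h_vec \<Delta> (d - r) * ?v r) * (\<Sum>r\<le>d. h_vec \<Delta> r * ?u r)
      \<le> (\<Sum>r\<le>d. h_vec \<Delta> (d - r) * ?u r) * (\<Sum>r\<le>d. h_vec \<Delta> r * ?v r)"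
  proof (intro sum_ratio_mono unrolled_blocks_ratio_mono assms(3))
    fix r s assume "r \<in> {..d}" "s \<in> {..d}" "r \<le> s"
    then show "h_vec \<Delta> (d - r) * h_vec \<Delta> s \<le> h_vec \<Delta> (d - s) * h_vec \<Delta> r"
      using antimono[of r s] by (simp add: mult.commute)
  qed
  then show ?thesis unfolding g by (simp only: mult.commute)
qed

lemma le_of_consecutive_le:
  fixes g :: "nat \<Rightarrow> real"
  assumes "\<And>i. m \<le> i \<Longrightarrow> i < n \<Longrightarrow> g i \<le> g (Suc i)" "m \<le> r" "r \<le> s" "s \<le> n"
  shows "g r \<le> g s"
  using assms(3,4)
proof (induction s rule: dec_induct)
  case (step k)
  then show ?case using assms(1)[of k] assms(2) by simp
qed simp

lemma int_ratio_le_iff: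
  fixes a b c d :: int
  assumes "0 < b" "0 < d"
  shows "real_of_int a / real_of_int b \<le> real_of_int c / real_of_int d \<longleftrightarrow> a * d \<le> c * b"
proof -
  have "real_of_int a / real_of_int b \<le> real_of_int c / real_of_int d
      \<longleftrightarrow> real_of_int (a * d) \<le> real_of_int (c * b)"
    using assms by (simp add: field_simps)
  then show ?thesis by (simp only: of_int_le_iff)
qed

lemma condition_a_barycentric_subdivision:
  assumes "simplicial_complex \<Delta>" "complex_dim \<Delta> = int d - 1" and a: "condition_a d \<Delta>"
  shows "condition_a d (barycentric_subdivision \<Delta>)"
proof -
  let ?h = "h_vec \<Delta>" and ?g = "h_vec (barycentric_subdivision \<Delta>)"
  have pos: "0 < ?h i" if "i \<le> d" for i using a that by (simp add: condition_a_def)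
  have mono: "?h r * ?h (d - s) \<le> ?h s * ?h (d - r)" if "r \<le> s" "s \<le> d" for r s
  proof -
    have "real_of_int (?h r) / real_of_int (?h (d - r)) \<le> real_of_int (?h s) / real_of_int (?h (d - s))"
      by (rule le_of_consecutive_le[of 0 d "\<lambda>i. real_of_int (?h i) / real_of_int (?h (d - i))"])
        (use a that in \<open>simp_all add: condition_a_def\<close>)
    then show ?thesis using int_ratio_le_iff[OF pos pos] by simp
  qed
  have gpos: "0 < ?g j" if "j \<le> d" for j
  proof -
    \<comment> \<open>An index with a positive coefficient of \<open>x\<close> to the power \<open>d - j\<close>: the first one, except
      among the constant terms, which vanish for all indices below \<open>d\<close>.\<close>
    define r where "r = (if j = d then d else 0)"
    have "0 < unrolled d (int (d - j) * (int d + 1) + int r)"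
      using that unrolled_block_start_pos[of "d - j" d] unrolled_first_pos[of d]
      by (cases "j = d") (simp_all add: r_def)
    moreover have "r \<le> d" by (simp add: r_def)
    ultimately show ?thesis
      unfolding h_vec_barycentric_subdivision[OF assms(1,2) that] using pos
      by (intro sum_pos2[of _ r]) (simp_all add: unrolled_nonneg less_imp_le)
  qed
  have "real_of_int (?g i) / real_of_int (?g (d - i)) \<le> real_of_int (?g (Suc i)) / real_of_int (?g (d - Suc i))"
    if "i < d" for i
    using h_ratio_mono_barycentric_subdivision[OF assms(1,2) that mono] gpos
    by (subst int_ratio_le_iff) auto
  then show ?thesis using gpos by (simp add: condition_a_def)
qed

text \<open>Here \<open>h\<^sub>0 = 1\<close> and \<open>h\<^sub>d = 0\<close>, so the cross-multiplied inequalities extend the given chain to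
  the indices \<open>0\<close> and \<open>d\<close>, with the ratio \<open>\<infinity>\<close> on the left and \<open>0\<close> on the right.\<close>

lemma condition_b_barycentric_subdivision:
  assumes "simplicial_complex \<Delta>" "complex_dim \<Delta> = int d - 1" and b: "condition_b d \<Delta>"
  shows "condition_b d (barycentric_subdivision \<Delta>)"
proof -
  let ?h = "h_vec \<Delta>" and ?g = "h_vec (barycentric_subdivision \<Delta>)"
  have pos: "0 < ?h i" if "1 \<le> i" "i < d" for i using b that by (simp add: condition_b_def)
  have h0: "?h 0 = 1" using h_vec_0 assms by blast
  have hd: "?h d = 0" using b by (simp add: condition_b_def)
  have nonneg: "0 \<le> ?h i" if "i \<le> d" for i
    using pos[of i] h0 hd that by (cases "i = 0 \<or> i = d") auto
  have antimono: "?h s * ?h (d - r) \<le> ?h r * ?h (d - s)" if "r \<le> s" "s \<le> d" for r s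
  proof (cases "r = 0 \<or> s = d")
    case True
    then have "?h s * ?h (d - r) = 0" using hd by auto
    also have "0 \<le> ?h r * ?h (d - s)" using that by (intro mult_nonneg_nonneg nonneg) auto
    finally show ?thesis .
  next
    case False
    have "- (real_of_int (?h r) / real_of_int (?h (d - r))) \<le> - (real_of_int (?h s) / real_of_int (?h (d - s)))"
      by (rule le_of_consecutive_le[of 1 "d - 1" "\<lambda>i. - (real_of_int (?h i) / real_of_int (?h (d - i)))"])
        (use b that False in \<open>auto simp: condition_b_def\<close>)
    then have "real_of_int (?h s) / real_of_int (?h (d - s)) \<le> real_of_int (?h r) / real_of_int (?h (d - r))"
      by simp
    moreover have "1 \<le> d - r" "d - r < d" "1 \<le> d - s" "d - s < d" using False that by auto
    ultimately show ?thesis by (simp only: int_ratio_le_iff pos)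
  qed
  have gpos: "0 < ?g j" if "1 \<le> j" "j < d" for j
  proof -
    have "0 < unrolled d (int (d - j) * (int d + 1) + int 0)"
      using that unrolled_block_start_pos[of "d - j" d] by simp
    moreover have "j \<le> d" using that by simp
    ultimately show ?thesis
      unfolding h_vec_barycentric_subdivision[OF assms(1,2) \<open>j \<le> d\<close>] using nonneg
      by (intro sum_pos2[of _ 0]) (auto simp: unrolled_nonneg h0)
  qed
  \<comment> \<open>The constant terms vanish for all indices below \<open>d\<close>, and the last one meets \<open>h\<^sub>d = 0\<close>.\<close>
  have "?h r * unrolled d (int r) = 0" if "r \<le> d" for r
    using that hd by (cases "r = d") (auto simp: unrolled_eq_0)
  then have "?g d = 0"
    unfolding h_vec_barycentric_subdivision[OF assms(1,2) order_refl] by (intro sum.neutral) auto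
  moreover have "real_of_int (?g (Suc i)) / real_of_int (?g (d - Suc i)) \<le> real_of_int (?g i) / real_of_int (?g (d - i))"
    if "1 \<le> i" "Suc i < d" for i
    using h_ratio_antimono_barycentric_subdivision[OF assms(1,2) _ antimono, of i] gpos that
    by (subst int_ratio_le_iff) auto
  ultimately show ?thesis using gpos by (simp add: condition_b_def)
qed

theorem corollary2p4:
  fixes \<Delta> :: "'a set set" and d :: nat
  assumes "d \<ge> 1"
    and "simplicial_complex \<Delta>"
    and "complex_dim \<Delta> = int d - 1"
  shows "(condition_a d \<Delta> \<longrightarrow> condition_a d (barycentric_subdivision \<Delta>)) \<and>
         (condition_b d \<Delta> \<longrightarrow> condition_b d (barycentric_subdivision \<Delta>))"
  using condition_a_barycentric_subdivision condition_b_barycentric_subdivision assms by blast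

end
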